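(* Let $\mathcal{C}=((A,\vee,\cdot,0,1),(A,\wedge,\ast,1,0),\alpha)$ be a general coupled semiring. Then $\mathbf{C}(\mathbf{L}(\mathcal{C}))=\mathcal{C}$.
   Context: A residuated lattice is an algebra $\mathcal{L}=(L,\vee,\wedge,\otimes,\rightarrow,0,1)$ of type $(2,2,2,2,0,0)$ such that for all $x,y,z\in L$: (i) $(L,\vee,\wedge,0,1)$ is a bounded lattice (with least element $0$, greatest element $1$ and induced order $\leq$); (ii) $(L,\otimes,1)$ is a commutative monoid; (iii) $x\leq y\rightarrow z$ if and only if $x\otimes y\leq z$. In a residuated lattice put $\neg x:=x\rightarrow 0$ and $x\oplus y:=\neg(\neg x\otimes\neg y)$. The residuated lattice satisfies the double negation law if $\neg\neg x=x$ for all $x\in L$. A commutative semiring is an algebra $(S,+,\cdot,0,1)$ of type $(2,2,0,0)$ such that for all $x,y,z\in S$: (i) $(S,+,0)$ and $(S,\cdot,1)$ are commutative monoids; (ii) $x(y+z)=xy+xz$; (iii) $x0=0$. In $(A,\wedge,\ast,1,0)$ the addition is $\wedge$ with neutral element $1$, and the multiplication is $\ast$ with neutral element $0$. Homomorphisms and isomorphisms of semirings preserve both operations and both constants, in the listed order. A general coupled semiring is an ordered triple $((A,\vee,\cdot,0,1),(A,\wedge,\ast,1,0),\alpha)$ such that for all $x,y\in A$: (i) $(A,\vee,\cdot,0,1)$ and $(A,\wedge,\ast,1,0)$ are commutative semirings; (ii) $(A,\vee,\wedge)$ is a lattice (with induced order $\leq$); (iii) $\alpha$ is an isomorphism from $(A,\vee,\cdot,0,1)$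 to $(A,\wedge,\ast,1,0)$; (iv) $\alpha(\alpha(x))=x$; (v) $x\leq y$ if and only if $\alpha(x)\ast y=1$. For a residuated lattice $\mathcal{L}=(L,\vee,\wedge,\otimes,\rightarrow,0,1)$ satisfying the double negation law, $\mathbf{C}(\mathcal{L}):=((L,\vee,\otimes,0,1),(L,\wedge,\oplus,1,0),\neg)$, which is a general coupled semiring. For a general coupled semiring $\mathcal{C}=((A,\vee,\cdot,0,1),(A,\wedge,\ast,1,0),\alpha)$, $\mathbf{L}(\mathcal{C}):=(A,\vee,\wedge,\cdot,\rightarrow,0,1)$ where $x\rightarrow y:=\alpha(x)\ast y$ for all $x,y\in A$ (so $\cdot$ plays the role of $\otimes$); it is a residuated lattice satisfying the double negation law. *)

theory Defs
  imports "HOL-Algebra.QuotRing"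
begin

text \<open>
  Algebras are HOL-Algebra style records with an explicit carrier set. Their operations are
  required to be extensional on the carrier (by means of \<^const>\<open>PiE\<close>), so that they are exactly
  the set-theoretic operations on the carrier and equality of records is equality of algebras.
\<close>

abbreviation binary_op :: "'a set \<Rightarrow> ('a \<Rightarrow> 'a \<Rightarrow> 'a) \<Rightarrow> bool"
  where "binary_op A f \<equiv> f \<in> A \<rightarrow>\<^sub>E A \<rightarrow>\<^sub>E A"

definition lattice_on :: "'a set \<Rightarrow> ('a \<Rightarrow> 'a \<Rightarrow> 'a) \<Rightarrow> ('a \<Rightarrow> 'a \<Rightarrow> 'a) \<Rightarrow> bool"
  where "lattice_on A jn mt \<longleftrightarrow>
    binary_op A jn \<and> binary_op A mt \<and>
    (\<forall>x\<in>A. \<forall>y\<in>A. jn x y = jn y x \<and> mt x y = mt y x) \<and>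
    (\<forall>x\<in>A. \<forall>y\<in>A. \<forall>z\<in>A. jn (jn x y) z = jn x (jn y z) \<and> mt (mt x y) z = mt x (mt y z)) \<and>
    (\<forall>x\<in>A. \<forall>y\<in>A. jn x (mt x y) = x \<and> mt x (jn x y) = x)"

definition induced_le :: "('a \<Rightarrow> 'a \<Rightarrow> 'a) \<Rightarrow> 'a \<Rightarrow> 'a \<Rightarrow> bool"
  where "induced_le jn x y \<longleftrightarrow> jn x y = y"

text \<open>
  In the following record \<^const>\<open>mult\<close> and \<^const>\<open>one\<close> are the multiplication and the greatest
  element of a residuated lattice.
\<close>

record 'a residuated = "'a monoid" +
  rjoin :: "'a \<Rightarrow> 'a \<Rightarrow> 'a"
  rmeet :: "'a \<Rightarrow> 'a \<Rightarrow> 'a"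
  rimp :: "'a \<Rightarrow> 'a \<Rightarrow> 'a"
  rbot :: 'a

definition residuated_lattice :: "'a residuated \<Rightarrow> bool"
  where "residuated_lattice L \<longleftrightarrow>
    lattice_on (carrier L) (rjoin L) (rmeet L) \<and>
    rbot L \<in> carrier L \<and> \<one>\<^bsub>L\<^esub> \<in> carrier L \<and>
    (\<forall>x\<in>carrier L. induced_le (rjoin L) (rbot L) x \<and> induced_le (rjoin L) x \<one>\<^bsub>L\<^esub>) \<and>
    comm_monoid L \<and>
    binary_op (carrier L) (mult L) \<and> binary_op (carrier L) (rimp L) \<and>
    (\<forall>x\<in>carrier L. \<forall>y\<in>carrier L. \<forall>z\<in>carrier L.
       induced_le (rjoin L) x (rimp L y z) \<longleftrightarrow> induced_le (rjoin L) (x \<otimes>\<^bsub>L\<^esub> y) z)"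

definition rneg :: "'a residuated \<Rightarrow> 'a \<Rightarrow> 'a"
  where "rneg L = (\<lambda>x\<in>carrier L. rimp L x (rbot L))"

definition rplus :: "'a residuated \<Rightarrow> 'a \<Rightarrow> 'a \<Rightarrow> 'a"
  where "rplus L = (\<lambda>x\<in>carrier L. \<lambda>y\<in>carrier L. rneg L (rneg L x \<otimes>\<^bsub>L\<^esub> rneg L y))"

definition double_negation :: "'a residuated \<Rightarrow> bool"
  where "double_negation L \<longleftrightarrow> (\<forall>x\<in>carrier L. rneg L (rneg L x) = x)"

text \<open>
  The record type \<^typ>\<open>'a ring\<close> and the locale \<^locale>\<open>semiring\<close> do not presuppose additive inverses.
\<close>

definition commutative_semiring :: "'a ring \<Rightarrow> bool"
  where "commutative_semiring R \<longleftrightarrow>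
    semiring R \<and> comm_monoid R \<and>
    binary_op (carrier R) (add R) \<and> binary_op (carrier R) (mult R)"

text \<open>\<^const>\<open>ring_iso\<close> does not mention preservation of zero.\<close>

definition semiring_iso :: "'a ring \<Rightarrow> 'b ring \<Rightarrow> ('a \<Rightarrow> 'b) set"
  where "semiring_iso R S =
    {h \<in> ring_iso R S. h \<in> extensional (carrier R) \<and> h \<zero>\<^bsub>R\<^esub> = \<zero>\<^bsub>S\<^esub>}"

type_synonym 'a semiring_pair = "'a ring \<times> 'a ring \<times> ('a \<Rightarrow> 'a)"

text \<open>
  In a triple \<open>(R, S, \<alpha>)\<close> the first three conditions say that \<open>R\<close> and \<open>S\<close> are of the form
  \<open>(A, \<or>, \<cdot>, 0, 1)\<close> and \<open>(A, \<and>, *, 1, 0)\<close>; in particular \<open>1\<close> is the one of \<open>R\<close> and the zero of \<open>S\<close>.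
\<close>

fun general_coupled_semiring :: "'a semiring_pair \<Rightarrow> bool"
  where "general_coupled_semiring (R, S, \<alpha>) \<longleftrightarrow>
    carrier S = carrier R \<and> \<zero>\<^bsub>S\<^esub> = \<one>\<^bsub>R\<^esub> \<and> \<one>\<^bsub>S\<^esub> = \<zero>\<^bsub>R\<^esub> \<and>
    commutative_semiring R \<and> commutative_semiring S \<and>
    lattice_on (carrier R) (add R) (add S) \<and>
    \<alpha> \<in> semiring_iso R S \<and>
    (\<forall>x\<in>carrier R. \<alpha> (\<alpha> x) = x) \<and>
    (\<forall>x\<in>carrier R. \<forall>y\<in>carrier R.
       induced_le (add R) x y \<longleftrightarrow> \<alpha> x \<otimes>\<^bsub>S\<^esub> y = \<one>\<^bsub>R\<^esub>)"

text \<open>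
  The two constructions below are total functions on records; mathematically, the first is meant
  for arguments satisfying \<^const>\<open>residuated_lattice\<close> and \<^const>\<open>double_negation\<close>, and the second
  for arguments satisfying \<^const>\<open>general_coupled_semiring\<close>.
\<close>

definition coupled_of_residuated :: "'a residuated \<Rightarrow> 'a semiring_pair"
  where "coupled_of_residuated L =
    (\<lparr>carrier = carrier L, mult = mult L, one = \<one>\<^bsub>L\<^esub>, zero = rbot L, add = rjoin L\<rparr>,
     \<lparr>carrier = carrier L, mult = rplus L, one = rbot L, zero = \<one>\<^bsub>L\<^esub>, add = rmeet L\<rparr>,
     rneg L)"

fun residuated_of_coupled :: "'a semiring_pair \<Rightarrow> 'a residuated"
  where "residuated_of_coupled (R, S, \<alpha>) =
    \<lparr>carrier = carrier R, mult = mult R, one = \<one>\<^bsub>R\<^esub>, rjoin = add R, rmeet = add S,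
     rimp = (\<lambda>x\<in>carrier R. \<lambda>y\<in>carrier R. \<alpha> x \<otimes>\<^bsub>S\<^esub> y), rbot = \<zero>\<^bsub>R\<^esub>\<rparr>"

end

theory Submission
  imports Defs
begin

text \<open>
  Both constructions keep the carrier, the lattice operations, the constants and the
  multiplication of the first semiring, so only the negation and the derived addition of the
  residuated lattice have to be recognised as \<open>\<alpha>\<close> and \<open>*\<close>. The element \<open>0\<close> is the unit of
  \<open>*\<close>, hence \<open>\<not> x = \<alpha> x * 0 = \<alpha> x\<close>. As \<open>\<alpha>\<close> is an involution that carries \<open>\<cdot>\<close> to \<open>*\<close>,
  De Morgan duality gives \<open>\<not> (\<not> x \<cdot> \<not> y) = \<alpha> (\<alpha> x) * \<alpha> (\<alpha> y) = x * y\<close>. The operations are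
  extensional on the carrier, so these pointwise identities are identities of functions.
\<close>

lemma restrict_binary_op:
  assumes "binary_op A f"
  shows "(\<lambda>x\<in>A. \<lambda>y\<in>A. f x y) = f"
proof -
  have "restrict (f x) A = f x" if "x \<in> A" for x
    using PiE_restrict[OF PiE_mem[OF assms that]] .
  then have "(\<lambda>x\<in>A. restrict (f x) A) = restrict f A"
    by (simp cong: restrict_cong)
  with assms show ?thesis
    by (simp add: PiE_restrict)
qed

lemma rneg_residuated_of_coupled:
  assumes "general_coupled_semiring (R, S, \<alpha>)"
  shows "rneg (residuated_of_coupled (R, S, \<alpha>)) = \<alpha>"
proof -
  have unit: "\<one>\<^bsub>S\<^esub> = \<zero>\<^bsub>R\<^esub>"
    and R: "semiring R" and S: "comm_monoid S"
    and hom: "\<alpha> \<in> ring_hom R S" and ext: "\<alpha> \<in> extensional (carrier R)"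
    using assms by (simp_all add: commutative_semiring_def semiring_iso_def ring_iso_def)
  interpret R: semiring R by (rule R)
  interpret S: comm_monoid S by (rule S)
  have "\<alpha> x \<otimes>\<^bsub>S\<^esub> \<zero>\<^bsub>R\<^esub> = \<alpha> x" if "x \<in> carrier R" for x
    using S.r_one[OF ring_hom_closed[OF hom that]] by (simp add: unit)
  then have "rneg (residuated_of_coupled (R, S, \<alpha>)) = restrict \<alpha> (carrier R)"
    by (simp add: rneg_def cong: restrict_cong)
  with ext show ?thesis
    by (simp add: extensional_restrict)
qed

lemma rplus_residuated_of_coupled:
  assumes "general_coupled_semiring (R, S, \<alpha>)"
  shows "rplus (residuated_of_coupled (R, S, \<alpha>)) = mult S"
proof -
  have carrier: "carrier S = carrier R" and S: "commutative_semiring S"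
    and hom: "\<alpha> \<in> ring_hom R S"
    and invol: "\<And>x. x \<in> carrier R \<Longrightarrow> \<alpha> (\<alpha> x) = x"
    using assms by (simp_all add: semiring_iso_def ring_iso_def)
  have closed: "\<alpha> x \<in> carrier R" if "x \<in> carrier R" for x
    using ring_hom_closed[OF hom that] by (simp add: carrier)
  have "\<alpha> (\<alpha> x \<otimes>\<^bsub>R\<^esub> \<alpha> y) = x \<otimes>\<^bsub>S\<^esub> y" if "x \<in> carrier R" "y \<in> carrier R" for x y
    using that by (simp add: ring_hom_mult[OF hom] closed invol)
  then have "rplus (residuated_of_coupled (R, S, \<alpha>))
      = (\<lambda>x\<in>carrier R. \<lambda>y\<in>carrier R. x \<otimes>\<^bsub>S\<^esub> y)"
    unfolding rplus_def rneg_residuated_of_coupled[OF assms]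
    by (simp cong: restrict_cong)
  also have "\<dots> = mult S"
    using S by (simp add: restrict_binary_op commutative_semiring_def flip: carrier)
  finally show ?thesis .
qed

theorem theorem13:
  fixes C :: "'a semiring_pair"
  assumes "general_coupled_semiring C"
  shows "coupled_of_residuated (residuated_of_coupled C) = C"
proof -
  obtain R S \<alpha> where C: "C = (R, S, \<alpha>)"
    by (cases C)
  note coupled = assms[unfolded C]
  have "carrier S = carrier R" "\<zero>\<^bsub>S\<^esub> = \<one>\<^bsub>R\<^esub>" "\<one>\<^bsub>S\<^esub> = \<zero>\<^bsub>R\<^esub>"
    using coupled by auto
  then show ?thesis
    unfolding C coupled_of_residuated_def
      rneg_residuated_of_coupled[OF coupled] rplus_residuated_of_coupled[OF coupled]
    by simp
qed

end
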